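(* Let $n>3$ be odd and $m<n$ a positive integer with $\gcd(m,n)=\gcd(m-1,n)=1$. Then $\langle L_n(m)\cup I\rangle$ does not contain any nontrivial normal neutrosophic subloop.
   Context: For $n>3$ odd and $m<n$ a positive integer with $\gcd(m,n)=\gcd(m-1,n)=1$, the loop $L_n(m)$ is the set $\{e,1,2,\dots,n\}$ with operation: $e\cdot i=i\cdot e=i$ for all $i$; $i\cdot i=e$ for all $i$; and for $i,j\in\{1,\dots,n\}$, $i\neq j$, $i\cdot j$ is the element $s\in\{1,\dots,n\}$ with $s\equiv mj-(m-1)i \pmod n$. The neutrosophic loop $\langle L_n(m)\cup I\rangle$ is the set $\{e,1,\dots,n,eI,1I,\dots,nI\}$ of $2(n+1)$ distinct symbols, with the product of $L_n(m)$ on $\{e,1,\dots,n\}$ and $x\cdot(yI)=(xI)\cdot y=(xI)\cdot(yI)=(x\cdot y)I$ for $x,y\in L_n(m)$. A neutrosophic subloop is a subset of the form $P\cup\{xI:x\in P\}$, where $P$ is a subloop of $L_n(m)$. A neutrosophic subloop $H$ is normal if $Hx=xH$, $(Hx)y=H(xy)$ and $y(xH)=(yx)H$ for all $x,y\in\langle L_n(m)\cup I\rangle$. It is nontrivial if it is different from $\{e,eI\}$ and from $\langle L_n(m)\cup I\rangle$. *)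

theory Defs
  imports "HOL-Number_Theory.Cong"
begin

datatype loop_elem = Unit | Num nat

definition L_carrier :: "nat \<Rightarrow> loop_elem set" where
  "L_carrier n = insert Unit (Num ` {1..n})"

text \<open>
  The residue is computed over the integers, because \<open>m j - (m - 1) i\<close> may be negative.
  The values outside \<open>L_carrier n\<close> are irrelevant.
\<close>

fun L_mult :: "nat \<Rightarrow> nat \<Rightarrow> loop_elem \<Rightarrow> loop_elem \<Rightarrow> loop_elem" where
  "L_mult n m Unit y = y"
| "L_mult n m x Unit = x"
| "L_mult n m (Num i) (Num j) =
     (if i = j then Unit
      else Num (THE s. s \<in> {1..n} \<and>
             [int s = int m * int j - (int m - 1) * int i] (mod int n)))"

definition is_loop :: "'a set \<Rightarrow> ('a \<Rightarrow> 'a \<Rightarrow> 'a) \<Rightarrow> bool" where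
  "is_loop S f \<longleftrightarrow>
     (\<forall>x\<in>S. \<forall>y\<in>S. f x y \<in> S) \<and>
     (\<exists>u\<in>S. \<forall>x\<in>S. f u x = x \<and> f x u = x) \<and>
     (\<forall>a\<in>S. \<forall>b\<in>S. \<exists>!x. x \<in> S \<and> f a x = b) \<and>
     (\<forall>a\<in>S. \<forall>b\<in>S. \<exists>!y. y \<in> S \<and> f y a = b)"

definition L_subloop :: "nat \<Rightarrow> nat \<Rightarrow> loop_elem set \<Rightarrow> bool" where
  "L_subloop n m P \<longleftrightarrow> P \<subseteq> L_carrier n \<and> is_loop P (L_mult n m)"

text \<open>\<open>Plain x\<close> stands for \<open>x\<close> and \<open>Indet x\<close> for the formal symbol \<open>x I\<close>.\<close>

datatype 'a neutro = Plain 'a | Indet 'a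

definition neutro_set :: "'a set \<Rightarrow> 'a neutro set" where
  "neutro_set P = Plain ` P \<union> Indet ` P"

fun neutro_mult :: "('a \<Rightarrow> 'a \<Rightarrow> 'a) \<Rightarrow> 'a neutro \<Rightarrow> 'a neutro \<Rightarrow> 'a neutro" where
  "neutro_mult f (Plain x) (Plain y) = Plain (f x y)"
| "neutro_mult f (Plain x) (Indet y) = Indet (f x y)"
| "neutro_mult f (Indet x) (Plain y) = Indet (f x y)"
| "neutro_mult f (Indet x) (Indet y) = Indet (f x y)"

definition NL_carrier :: "nat \<Rightarrow> loop_elem neutro set" where
  "NL_carrier n = neutro_set (L_carrier n)"

definition NL_mult ::
    "nat \<Rightarrow> nat \<Rightarrow> loop_elem neutro \<Rightarrow> loop_elem neutro \<Rightarrow> loop_elem neutro" where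
  "NL_mult n m = neutro_mult (L_mult n m)"

definition neutro_subloop :: "nat \<Rightarrow> nat \<Rightarrow> loop_elem neutro set \<Rightarrow> bool" where
  "neutro_subloop n m H \<longleftrightarrow> (\<exists>P. L_subloop n m P \<and> H = neutro_set P)"

definition right_translate :: "('a \<Rightarrow> 'a \<Rightarrow> 'a) \<Rightarrow> 'a set \<Rightarrow> 'a \<Rightarrow> 'a set" where
  "right_translate f H x = (\<lambda>h. f h x) ` H"

definition left_translate :: "('a \<Rightarrow> 'a \<Rightarrow> 'a) \<Rightarrow> 'a \<Rightarrow> 'a set \<Rightarrow> 'a set" where
  "left_translate f x H = (\<lambda>h. f x h) ` H"

definition normal_neutro_subloop :: "nat \<Rightarrow> nat \<Rightarrow> loop_elem neutro set \<Rightarrow> bool" where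
  "normal_neutro_subloop n m H \<longleftrightarrow>
     neutro_subloop n m H \<and>
     (\<forall>x\<in>NL_carrier n. right_translate (NL_mult n m) H x = left_translate (NL_mult n m) x H) \<and>
     (\<forall>x\<in>NL_carrier n. \<forall>y\<in>NL_carrier n.
        right_translate (NL_mult n m) (right_translate (NL_mult n m) H x) y
          = right_translate (NL_mult n m) H (NL_mult n m x y) \<and>
        left_translate (NL_mult n m) y (left_translate (NL_mult n m) x H)
          = left_translate (NL_mult n m) (NL_mult n m y x) H)"

definition nontrivial_neutro_subloop :: "nat \<Rightarrow> loop_elem neutro set \<Rightarrow> bool" where
  "nontrivial_neutro_subloop n H \<longleftrightarrow> H \<noteq> {Plain Unit, Indet Unit} \<and> H \<noteq> NL_carrier n"

end

theory Submission
  imports Defs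
begin

text \<open>
  Index the non-unit elements of \<open>L\<^sub>n(m)\<close> by residues modulo \<open>n\<close>, so that \<open>a \<cdot> b\<close> is
  \<open>m b - (m - 1) a\<close> when \<open>a\<close> and \<open>b\<close> are incongruent. Let \<open>P\<close> be the subloop that underlies a
  normal neutrosophic subloop, and let \<open>A\<close> be the set of residues in \<open>P\<close>. Assume that neither \<open>A\<close>
  nor its complement is empty. Two facts collide.

  First, since \<open>P\<close> is closed under both divisions, \<open>A\<close> is closed under \<open>(x, y, z) \<mapsto> x + y - z\<close>
  (\<open>subloop_affine\<close>), that is, \<open>A\<close> is a coset of a subgroup of the residues.

  Secondly, normality makes \<open>P j = P (i j)\<close> for \<open>i \<in> A\<close> and \<open>j \<notin> A\<close>. For \<open>i' \<in> A\<close> this puts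
  \<open>i' (i j)\<close> into \<open>P j\<close>. If it were of the form \<open>k j\<close> with \<open>k \<in> A\<close>, then \<open>k \<equiv> i' + m (i - j)\<close>, and the
  affine closure of \<open>A\<close> would force \<open>j \<in> A\<close>. Hence \<open>i' (i j) = j\<close> for all \<open>i, i' \<in> A\<close>
  (\<open>normal_subloop_returns\<close>), and cancelling leaves only one element \<open>i\<close> in \<open>A\<close>. Thus \<open>j\<close> may be any
  other residue, and \<open>i (i j) = j\<close> with \<open>j = i + 1\<close> says \<open>m\<^sup>2 \<equiv> 1\<close>. Finally \<open>(P j) j = P (j j) = P\<close>
  puts \<open>(i j) j\<close> into \<open>P\<close>, so that it equals \<open>i\<close>, which says \<open>(m - 1)\<^sup>2 \<equiv> 1\<close>. Subtracting,
  \<open>2 m \<equiv> 1\<close>, whence \<open>1 \<equiv> 4 m\<^sup>2 \<equiv> 4\<close> and \<open>n\<close> divides \<open>3\<close>, contrary to \<open>n > 3\<close>.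
\<close>

section \<open>Residue coordinates on the loop\<close>

text \<open>
  Any integer serves as an index: the shift by one selects the representative of \<open>a\<close> modulo \<open>n\<close> in
  \<open>{1..n}\<close> instead of \<open>{0..<n}\<close>.
\<close>

definition residue_elem :: "nat \<Rightarrow> int \<Rightarrow> loop_elem" where
  "residue_elem n a = Num (nat ((a - 1) mod int n) + 1)"

lemma residue_elem_eq_Num:
  assumes "n > 0" "s \<in> {1..n}" "[int s = a] (mod int n)"
  shows "residue_elem n a = Num s"
proof -
  have "(a - 1) mod int n = (int s - 1) mod int n"
    using assms(3) by (metis cong_def mod_diff_left_eq)
  also have "\<dots> = int s - 1" using assms(2) by simp
  finally show ?thesis
    using assms(2) by (auto simp: residue_elem_def nat_diff_distrib)
qed

lemma residue_elem_rep:
  assumes "n > 0"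
  obtains s where "s \<in> {1..n}" "[int s = a] (mod int n)" "residue_elem n a = Num s"
proof -
  let ?s = "nat ((a - 1) mod int n) + 1"
  have b: "0 \<le> (a - 1) mod int n" "(a - 1) mod int n < int n" using assms by auto
  have "[int ?s = a] (mod int n)"
    using b(1) by (simp add: cong_def mod_simps)
  moreover have "?s \<in> {1..n}" using b by auto
  moreover have "residue_elem n a = Num ?s" by (simp add: residue_elem_def)
  ultimately show ?thesis using that by blast
qed

lemma residue_elem_eq_iff:
  assumes "n > 0"
  shows "residue_elem n a = residue_elem n b \<longleftrightarrow> [a = b] (mod int n)"
proof -
  obtain s where s: "s \<in> {1..n}" "[int s = a] (mod int n)" "residue_elem n a = Num s"
    using residue_elem_rep[OF assms] .
  obtain t where t: "t \<in> {1..n}" "[int t = b] (mod int n)" "residue_elem n b = Num t"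
    using residue_elem_rep[OF assms] .
  show ?thesis
    using s t residue_elem_eq_Num[OF assms] by (metis cong_sym cong_trans loop_elem.inject)
qed

lemma residue_elem_neq_Unit [simp]: "residue_elem n a \<noteq> Unit" "Unit \<noteq> residue_elem n a"
  by (simp_all add: residue_elem_def)

lemma residue_elem_in_carrier:
  "n > 0 \<Longrightarrow> residue_elem n a \<in> L_carrier n"
  by (metis L_carrier_def imageI insertCI residue_elem_rep)

lemma L_carrier_cases [consumes 2, case_names Unit residue]:
  assumes "n > 0" "x \<in> L_carrier n"
  obtains (Unit) "x = Unit" | (residue) a where "x = residue_elem n a"
proof (cases x)
  case (Num s)
  then have "x = residue_elem n (int s)"
    using assms by (auto simp: L_carrier_def residue_elem_eq_Num)
  then show ?thesis by (rule residue)
qed (rule Unit)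

lemma L_mult_Unit_right [simp]: "L_mult n m x Unit = x"
  by (cases x) auto

lemma L_mult_residue_elem:
  assumes "n > 0"
  shows "L_mult n m (residue_elem n a) (residue_elem n b) =
    (if [a = b] (mod int n) then Unit
     else residue_elem n (int m * b - (int m - 1) * a))"
proof -
  obtain s where s: "s \<in> {1..n}" "[int s = a] (mod int n)" "residue_elem n a = Num s"
    using residue_elem_rep[OF assms] .
  obtain t where t: "t \<in> {1..n}" "[int t = b] (mod int n)" "residue_elem n b = Num t"
    using residue_elem_rep[OF assms] .
  let ?c = "int m * b - (int m - 1) * a" and ?c' = "int m * int t - (int m - 1) * int s"
  have c: "[?c' = ?c] (mod int n)"
    using s(2) t(2) by (intro cong_diff cong_mult) auto
  obtain r where r: "r \<in> {1..n}" "[int r = ?c] (mod int n)" "residue_elem n ?c = Num r"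
    using residue_elem_rep[OF assms] .
  have "(THE u. u \<in> {1..n} \<and> [int u = ?c'] (mod int n)) = r"
  proof (rule the_equality)
    show "r \<in> {1..n} \<and> [int r = ?c'] (mod int n)"
      using r c by (meson cong_sym cong_trans)
  next
    fix u assume "u \<in> {1..n} \<and> [int u = ?c'] (mod int n)"
    then have "residue_elem n ?c = Num u"
      using c by (meson cong_trans residue_elem_eq_Num[OF assms])
    then show "u = r" using r(3) by simp
  qed
  moreover have "s = t \<longleftrightarrow> [a = b] (mod int n)"
    using residue_elem_eq_iff[OF assms, of a b] s(3) t(3) by simp
  ultimately show ?thesis using s(3) t(3) r(3) by simp
qed

section \<open>Subloops are affine\<close>

text \<open>Every product of a non-unit element with itself is the unit, so no other element can be neutral.\<close>

lemma subloop_Unit: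
  assumes "L_subloop n m P"
  shows "Unit \<in> P"
proof -
  obtain u where u: "u \<in> P" "L_mult n m u u = u"
    using assms by (auto simp: L_subloop_def is_loop_def)
  then show ?thesis by (cases u) auto
qed

lemma subloop_closed:
  "L_subloop n m P \<Longrightarrow> x \<in> P \<Longrightarrow> y \<in> P \<Longrightarrow> L_mult n m x y \<in> P"
  by (auto simp: L_subloop_def is_loop_def)

text \<open>
  Divisions inside a subloop, in coordinates. They also hold when \<open>a\<close> and \<open>b\<close> are congruent,
  since \<open>m a - (m - 1) a = a\<close>: this idempotent completion of the product is what is affine.
\<close>

lemma subloop_left_division:
  assumes "n > 0" "L_subloop n m P" "residue_elem n a \<in> P" "residue_elem n b \<in> P"
  obtains c where "residue_elem n c \<in> P" "[int m * c - (int m - 1) * a = b] (mod int n)"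
proof (cases "[a = b] (mod int n)")
  case True
  then show ?thesis using that[of a] assms(3) by (simp add: algebra_simps)
next
  case False
  have "\<forall>a\<in>P. \<forall>b\<in>P. \<exists>!x. x \<in> P \<and> L_mult n m a x = b"
    using assms(2) unfolding L_subloop_def is_loop_def by (elim conjE)
  then obtain x where x: "x \<in> P" "L_mult n m (residue_elem n a) x = residue_elem n b"
    using assms(3,4) by blast
  have "x \<in> L_carrier n" using x(1) assms(2) by (auto simp: L_subloop_def)
  with assms(1) show ?thesis
  proof (cases rule: L_carrier_cases)
    case Unit
    then show ?thesis using x(2) False residue_elem_eq_iff[OF assms(1)] by simp
  next
    case (residue c)
    then show ?thesis using x that[of c] residue_elem_eq_iff[OF assms(1)]
      by (auto simp: L_mult_residue_elem[OF assms(1)] split: if_splits)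
  qed
qed

lemma subloop_right_division:
  assumes "n > 0" "L_subloop n m P" "residue_elem n a \<in> P" "residue_elem n b \<in> P"
  obtains c where "residue_elem n c \<in> P" "[int m * a - (int m - 1) * c = b] (mod int n)"
proof (cases "[a = b] (mod int n)")
  case True
  then show ?thesis using that[of a] assms(3) by (simp add: algebra_simps)
next
  case False
  have "\<forall>a\<in>P. \<forall>b\<in>P. \<exists>!x. x \<in> P \<and> L_mult n m x a = b"
    using assms(2) unfolding L_subloop_def is_loop_def by (elim conjE)
  then obtain x where x: "x \<in> P" "L_mult n m x (residue_elem n a) = residue_elem n b"
    using assms(3,4) by blast
  have "x \<in> L_carrier n" using x(1) assms(2) by (auto simp: L_subloop_def)
  with assms(1) show ?thesis
  proof (cases rule: L_carrier_cases)
    case Unit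
    then show ?thesis using x(2) False residue_elem_eq_iff[OF assms(1)] by simp
  next
    case (residue c)
    then show ?thesis using x that[of c] residue_elem_eq_iff[OF assms(1)]
      by (auto simp: L_mult_residue_elem[OF assms(1)] split: if_splits)
  qed
qed

lemma subloop_combination:
  assumes "n > 0" "L_subloop n m P" "residue_elem n a \<in> P" "residue_elem n b \<in> P"
  shows "residue_elem n (int m * b - (int m - 1) * a) \<in> P"
proof (cases "[a = b] (mod int n)")
  case True
  then have "[int m * b - (int m - 1) * a = int m * b - (int m - 1) * b] (mod int n)"
    by (intro cong_diff cong_mult) auto
  then have "[int m * b - (int m - 1) * a = b] (mod int n)" by (simp add: algebra_simps)
  then show ?thesis using assms(4) residue_elem_eq_iff[OF assms(1)] by metis
next
  case False
  then show ?thesis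
    using subloop_closed[OF assms(2-4)] by (simp add: L_mult_residue_elem[OF assms(1)])
qed

text \<open>
  Divide to write \<open>x = z \<cdot> u\<close> and \<open>y = t \<cdot> z\<close> inside the subloop; then \<open>t \<cdot> u\<close> is \<open>x + y - z\<close>, because the
  contributions of \<open>z\<close> to \<open>x\<close> and to \<open>y\<close> add up to \<open>m z - (m - 1) z = z\<close>.
\<close>

lemma subloop_affine:
  assumes "n > 0" "L_subloop n m P"
    and "residue_elem n x \<in> P" "residue_elem n y \<in> P" "residue_elem n z \<in> P"
  shows "residue_elem n (x + y - z) \<in> P"
proof -
  obtain u where u: "residue_elem n u \<in> P" "[int m * u - (int m - 1) * z = x] (mod int n)"
    using subloop_left_division[OF assms(1,2,5,3)] .
  obtain t where t: "residue_elem n t \<in> P" "[int m * z - (int m - 1) * t = y] (mod int n)"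
    using subloop_right_division[OF assms(1,2,5,4)] .
  have "[(int m * u - (int m - 1) * z) + (int m * z - (int m - 1) * t) - z = x + y - z] (mod int n)"
    using u(2) t(2) by (intro cong_diff cong_add) auto
  then have "[int m * u - (int m - 1) * t = x + y - z] (mod int n)"
    by (simp add: algebra_simps)
  then show ?thesis
    using subloop_combination[OF assms(1,2) t(1) u(1)] residue_elem_eq_iff[OF assms(1)] by metis
qed

section \<open>Consequences of normality\<close>

text \<open>
  Comparing the plain parts of both sides of \<open>(H x) y = H (x y)\<close> transfers this identity from the
  neutrosophic loop to \<open>L\<^sub>n(m)\<close>.
\<close>

lemma normal_imp_translates_eq:
  assumes "normal_neutro_subloop n m (neutro_set P)" "x \<in> L_carrier n" "y \<in> L_carrier n"
  shows "(\<lambda>h. L_mult n m (L_mult n m h x) y) ` P = (\<lambda>h. L_mult n m h (L_mult n m x y)) ` P"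
proof -
  have translate: "right_translate (NL_mult n m) (neutro_set Q) (Plain z)
      = neutro_set ((\<lambda>h. L_mult n m h z) ` Q)" for Q z
    by (simp add: right_translate_def NL_mult_def neutro_set_def image_Un image_image)
  have inj: "Q = R" if "neutro_set Q = neutro_set R" for Q R :: "loop_elem set"
  proof -
    have "Plain -` neutro_set S = S" for S :: "loop_elem set" by (auto simp: neutro_set_def)
    then show ?thesis using that by metis
  qed
  have "Plain x \<in> NL_carrier n" "Plain y \<in> NL_carrier n"
    using assms(2,3) by (auto simp: NL_carrier_def neutro_set_def)
  then have "right_translate (NL_mult n m)
        (right_translate (NL_mult n m) (neutro_set P) (Plain x)) (Plain y)
      = right_translate (NL_mult n m) (neutro_set P) (NL_mult n m (Plain x) (Plain y))"
    using assms(1) unfolding normal_neutro_subloop_def by blast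
  moreover have "NL_mult n m (Plain x) (Plain y) = Plain (L_mult n m x y)"
    by (simp add: NL_mult_def)
  ultimately have "neutro_set ((\<lambda>h. L_mult n m h y) ` (\<lambda>h. L_mult n m h x) ` P)
      = neutro_set ((\<lambda>h. L_mult n m h (L_mult n m x y)) ` P)"
    by (simp only: translate)
  from inj[OF this] show ?thesis by (simp only: image_image)
qed

text \<open>
  Since \<open>P i = P\<close>, normality gives \<open>P (i j) = P j\<close>, so \<open>i' (i j)\<close> is either \<open>j\<close> or \<open>k j\<close> with \<open>k\<close> in
  the subloop. The latter means \<open>k \<equiv> i' + m (i - j)\<close>, as \<open>m - 1\<close> can be cancelled. Then
  \<open>i + m (i - j)\<close> lies in the subloop by affinity, so does \<open>2 i - j\<close> by left division by \<open>i\<close>, and by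
  affinity so does \<open>j\<close>.
\<close>

lemma normal_subloop_returns:
  assumes n: "n > 0" and cop: "coprime (int m) (int n)" "coprime (int m - 1) (int n)"
    and P: "L_subloop n m P" and normal: "normal_neutro_subloop n m (neutro_set P)"
    and i: "residue_elem n i \<in> P" and i': "residue_elem n i' \<in> P"
    and j: "residue_elem n j \<notin> P"
  shows "[int m * (int m * j - (int m - 1) * i) - (int m - 1) * i' = j] (mod int n)"
proof -
  let ?f = "L_mult n m" and ?e = "residue_elem n"
  let ?s = "int m * j - (int m - 1) * i"
  note mult = L_mult_residue_elem[OF n] and eq = residue_elem_eq_iff[OF n]
  have "\<not> [i = j] (mod int n)" using i j eq by metis
  then have ij: "?f (?e i) (?e j) = ?e ?s" by (simp add: mult)
  have "?f (?e i') (?e ?s) \<in> (\<lambda>h. ?f h (?f (?e i) (?e j))) ` P"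
    using i' ij by auto
  also have "\<dots> = (\<lambda>h. ?f (?f h (?e i)) (?e j)) ` P"
    using normal_imp_translates_eq[OF normal] residue_elem_in_carrier[OF n] by blast
  finally obtain p where p: "p \<in> P" "?f (?e i') (?e ?s) = ?f p (?e j)"
    using subloop_closed[OF P _ i] by blast
  have pL: "p \<in> L_carrier n" using p(1) P by (auto simp: L_subloop_def)
  have "?f p (?e j) \<noteq> Unit"
    using n pL
  proof (cases rule: L_carrier_cases)
    case (residue k)
    then have "\<not> [k = j] (mod int n)" using p(1) j eq by metis
    then show ?thesis using residue by (simp add: mult)
  qed simp
  then have prod: "?f (?e i') (?e ?s) = ?e (int m * ?s - (int m - 1) * i')"
    unfolding p(2)[symmetric] mult by presburger
  from n pL show ?thesis
  proof (cases rule: L_carrier_cases)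
    case Unit
    then show ?thesis using p(2) prod eq by simp
  next
    case (residue k)
    have "\<not> [k = j] (mod int n)" using p(1) j residue eq by metis
    then have "?f p (?e j) = ?e (int m * j - (int m - 1) * k)"
      using residue by (simp add: mult)
    then have "[int m * ?s - (int m - 1) * i' = int m * j - (int m - 1) * k] (mod int n)"
      using p(2) prod eq by metis
    then have "[(int m - 1) * k = (int m - 1) * (i' + int m * (i - j))] (mod int n)"
      by (simp add: cong_iff_dvd_diff algebra_simps)
    then have "[k = i' + int m * (i - j)] (mod int n)"
      using cop(2) by (simp add: cong_mult_lcancel)
    then have "?e (i' + int m * (i - j)) \<in> P" using p(1) residue eq by metis
    from subloop_affine[OF n P this i i']
    have "?e (i + int m * (i - j)) \<in> P" by (simp add: algebra_simps)
    then obtain c where c: "?e c \<in> P"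
        "[int m * c - (int m - 1) * i = i + int m * (i - j)] (mod int n)"
      using subloop_left_division[OF n P i] by blast
    have "[int m * c = int m * (2 * i - j)] (mod int n)"
      using c(2) by (simp add: cong_iff_dvd_diff algebra_simps)
    then have "[c = 2 * i - j] (mod int n)" using cop(1) by (simp add: cong_mult_lcancel)
    then have "?e (2 * i - j) \<in> P" using c(1) eq by metis
    from subloop_affine[OF n P i i this] have "?e j \<in> P" by simp
    then show ?thesis using j by simp
  qed
qed

text \<open>The element is \<open>(i j) j\<close>, which lies in \<open>(P j) j = P (j j) = P\<close>.\<close>

lemma normal_subloop_double_translate:
  assumes n: "n > 0" and cop: "coprime (int m - 1) (int n)"
    and normal: "normal_neutro_subloop n m (neutro_set P)"
    and i: "residue_elem n i \<in> P" and ij: "\<not> [i = j] (mod int n)"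
  shows "residue_elem n (j + (int m - 1)\<^sup>2 * (i - j)) \<in> P"
proof -
  let ?f = "L_mult n m" and ?e = "residue_elem n"
  let ?s = "int m * j - (int m - 1) * i"
  note mult = L_mult_residue_elem[OF n]
  have "\<not> [?s = j] (mod int n)"
  proof
    assume "[?s = j] (mod int n)"
    then have "[(int m - 1) * j = (int m - 1) * i] (mod int n)"
      by (simp add: cong_iff_dvd_diff algebra_simps)
    then show False using cop ij by (simp add: cong_mult_lcancel cong_sym_eq)
  qed
  then have "?f (?f (?e i) (?e j)) (?e j) = ?e (int m * j - (int m - 1) * ?s)"
    using ij by (simp add: mult)
  also have "int m * j - (int m - 1) * ?s = j + (int m - 1)\<^sup>2 * (i - j)"
    by (simp add: algebra_simps power2_eq_square)
  finally have "?e (j + (int m - 1)\<^sup>2 * (i - j)) \<in> (\<lambda>h. ?f (?f h (?e j)) (?e j)) ` P"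
    using i by force
  also have "\<dots> = (\<lambda>h. ?f h (?f (?e j) (?e j))) ` P"
    using normal_imp_translates_eq[OF normal] residue_elem_in_carrier[OF n] by blast
  also have "\<dots> = P" by (simp add: mult)
  finally show ?thesis .
qed

lemma normal_subloop_trivial:
  assumes n: "n > 3" and cop: "coprime (int m) (int n)" "coprime (int m - 1) (int n)"
    and P: "L_subloop n m P" and normal: "normal_neutro_subloop n m (neutro_set P)"
  shows "P = {Unit} \<or> P = L_carrier n"
proof (rule ccontr)
  assume nontriv: "\<not> (P = {Unit} \<or> P = L_carrier n)"
  have n0: "n > 0" using n by simp
  let ?e = "residue_elem n"
  note eq = residue_elem_eq_iff[OF n0]
  have PL: "P \<subseteq> L_carrier n" using P by (simp add: L_subloop_def)
  have "\<exists>x\<in>P. x \<noteq> Unit" using nontriv subloop_Unit[OF P] by blast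
  then obtain i where i: "?e i \<in> P"
    using PL by (blast elim: L_carrier_cases[OF n0])
  have "\<exists>x\<in>L_carrier n. x \<notin> P" using nontriv PL by blast
  then obtain j where j: "?e j \<notin> P"
    using subloop_Unit[OF P] by (blast elim: L_carrier_cases[OF n0])
  have single: "[k = i] (mod int n)" if k: "?e k \<in> P" for k
  proof -
    let ?t = "int m * (int m * j - (int m - 1) * i)"
    have "[?t - (int m - 1) * k = ?t - (int m - 1) * i] (mod int n)"
      using normal_subloop_returns[OF n0 cop P normal i k j]
        normal_subloop_returns[OF n0 cop P normal i i j] by (meson cong_sym cong_trans)
    then have "[(int m - 1) * i = (int m - 1) * k] (mod int n)"
      by (simp add: cong_iff_dvd_diff algebra_simps)
    then show ?thesis using cop(2) by (simp add: cong_mult_lcancel cong_sym_eq)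
  qed
  have next_ne: "\<not> [i = i + 1] (mod int n)" "?e (i + 1) \<notin> P"
    using n single[of "i + 1"] by (auto simp: cong_iff_dvd_diff)
  have sq: "int n dvd (int m)\<^sup>2 - 1"
    using normal_subloop_returns[OF n0 cop P normal i i next_ne(2)]
    by (simp add: cong_iff_dvd_diff algebra_simps power2_eq_square)
  have "int n dvd 1 - (int m - 1)\<^sup>2"
    using single[OF normal_subloop_double_translate[OF n0 cop(2) normal i next_ne(1)]]
    by (simp add: cong_iff_dvd_diff)
  with sq have "int n dvd ((int m)\<^sup>2 - 1) + (1 - (int m - 1)\<^sup>2)" by (rule dvd_add)
  then have "int n dvd 2 * int m - 1" by (simp add: algebra_simps power2_eq_square)
  \<comment> \<open>The combination eliminates \<open>m\<close>: \<open>4 (m\<^sup>2 - 1) - (2 m + 1) (2 m - 1) = - 3\<close>.\<close>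
  with sq have "int n dvd 4 * ((int m)\<^sup>2 - 1) - (2 * int m + 1) * (2 * int m - 1)"
    by (simp only: dvd_diff dvd_mult)
  then have "int n dvd - 3" by (simp add: algebra_simps power2_eq_square)
  then have "int n dvd 3" by simp
  then have "int n \<le> 3" by (rule zdvd_imp_le) simp
  then show False using n by simp
qed

theorem theorem4p1p7:
  fixes n m :: nat
  assumes "n > 3" and "odd n"
    and "0 < m" and "m < n"
    and "gcd m n = 1" and "gcd (m - 1) n = 1"
  shows "\<not> (\<exists>H. normal_neutro_subloop n m H \<and> nontrivial_neutro_subloop n H)"
proof
  assume "\<exists>H. normal_neutro_subloop n m H \<and> nontrivial_neutro_subloop n H"
  then obtain H where H: "normal_neutro_subloop n m H" "nontrivial_neutro_subloop n H"
    by blast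
  then obtain P where P: "L_subloop n m P" "H = neutro_set P"
    by (auto simp: normal_neutro_subloop_def neutro_subloop_def)
  have "coprime (int m) (int n)" using assms(5) by (simp add: coprime_iff_gcd_eq_1)
  moreover have "coprime (int (m - 1)) (int n)"
    using assms(6) by (metis coprime_iff_gcd_eq_1 coprime_int_iff)
  then have "coprime (int m - 1) (int n)" using assms(3) by (simp add: of_nat_diff)
  ultimately have "P = {Unit} \<or> P = L_carrier n"
    using normal_subloop_trivial[OF assms(1)] P H(1) by simp
  then show False
    using H(2) P(2) by (auto simp: nontrivial_neutro_subloop_def NL_carrier_def neutro_set_def)
qed

end
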